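(* Let $m\ge 3$ and let $W(C_m)$ denote the whiskered cycle. Then for each $1\le k\le \nu(W(C_m))=m$, we have $$\operatorname{depth}\bigl(R/I(W(C_m))^{[k]}\bigr)\le m+k-1.$$
   Context: All graphs are finite and simple. Fix a field $\mathbb{K}$. For a graph $G$ with vertex set $V(G)$ (vertices are identified with indeterminates), $R=\mathbb{K}[x\mid x\in V(G)]$ and $I(G)=\langle xy\mid \{x,y\}\in E(G)\rangle\subseteq R$ is the edge ideal. A $k$-matching of $G$ is a set of $k$ pairwise disjoint edges; $\nu(G)$ is the maximum cardinality of a matching. The $k$-th square-free power $I(G)^{[k]}$ is the ideal of $R$ generated by the square-free monomials of $I(G)^k$; equivalently it is generated by the products $\prod_{x\in \bigcup_{e\in M}e}x$ over all $k$-matchings $M$ of $G$. The whiskered cycle $W(C_m)$ has vertices $x_1,\dots,x_m,y_1,\dots,y_m$ and edges $\{x_i,x_{i+1}\}$ ($1\le i\le m-1$), $\{x_1,x_m\}$, and $\{x_i,y_i\}$ ($1\le i\le m$); here $R$ is the polynomial ring over $\mathbb{K}$ in these $2m$ variables. *)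

theory Defs
  imports "HOL-Algebra.Algebra" "HOL-Library.Disjoint_Sets" "HOL-Library.Poly_Mapping" "HOL-Library.Extended_Nat"
begin

section \<open>Finite simple graphs and matchings\<close>

record 'v graph =
  verts :: "'v set"
  edges :: "'v set set"

definition finite_simple_graph :: "'v graph \<Rightarrow> bool" where
  "finite_simple_graph G \<longleftrightarrow>
     finite (verts G) \<and> (\<forall>e \<in> edges G. e \<subseteq> verts G \<and> card e = 2)"

definition is_matching :: "'v graph \<Rightarrow> 'v set set \<Rightarrow> bool" where
  "is_matching G M \<longleftrightarrow> M \<subseteq> edges G \<and> disjoint M"

definition matching_number :: "'v graph \<Rightarrow> nat" where
  "matching_number G = Max (card ` {M. is_matching G M})"

datatype wvertex = Vx nat | Vy nat

definition whiskered_cycle :: "nat \<Rightarrow> wvertex graph" where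
  "whiskered_cycle m =
     \<lparr>verts = Vx ` {1..m} \<union> Vy ` {1..m},
      edges = {{Vx i, Vx (i + 1)} | i. 1 \<le> i \<and> i \<le> m - 1} \<union> {{Vx 1, Vx m}}
              \<union> {{Vx i, Vy i} | i. 1 \<le> i \<and> i \<le> m}\<rparr>"

lemma finite_simple_graph_whiskered_cycle:
  assumes "m \<ge> 3"
  shows "finite_simple_graph (whiskered_cycle m)"
  using assms by (auto simp: finite_simple_graph_def whiskered_cycle_def card_insert_if)


section \<open>Polynomial rings\<close>

text \<open>A polynomial over \<open>'k\<close> is a finitely supported map from monomials (finitely supported
  exponent vectors) to coefficients; multiplication on \<^typ>\<open>('v \<Rightarrow>\<^sub>0 nat) \<Rightarrow>\<^sub>0 'k::field\<close> is
  convolution. As the type \<open>'v\<close> may be infinite, the ring \<open>'k[x | x \<in> V]\<close> is cut out as a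
  carrier set, namely the polynomials involving only indeterminates from \<open>V\<close>.\<close>

type_synonym ('v, 'k) mpoly = "('v \<Rightarrow>\<^sub>0 nat) \<Rightarrow>\<^sub>0 'k"

definition indets :: "('v, 'k::zero) mpoly \<Rightarrow> 'v set" where
  "indets p = (\<Union>t \<in> Poly_Mapping.keys p. Poly_Mapping.keys t)"

definition poly_ring :: "'v set \<Rightarrow> ('v, 'k::field) mpoly ring" where
  "poly_ring V =
     \<lparr>carrier = {p. indets p \<subseteq> V}, monoid.mult = (*), one = 1, ring.zero = 0, add = (+)\<rparr>"

definition monomial :: "('v \<Rightarrow>\<^sub>0 nat) \<Rightarrow> ('v, 'k::field) mpoly" where
  "monomial t = Poly_Mapping.single t 1"

definition indet :: "'v \<Rightarrow> ('v, 'k::field) mpoly" where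
  "indet x = monomial (Poly_Mapping.single x 1)"

definition squarefree_monomial :: "('v, 'k::field) mpoly \<Rightarrow> bool" where
  "squarefree_monomial p \<longleftrightarrow> (\<exists>t. p = monomial t \<and> (\<forall>x. Poly_Mapping.lookup t x \<le> 1))"

lemma cring_poly_ring: "cring (poly_ring V :: ('v, 'k::field) mpoly ring)"
proof (intro cringI abelian_groupI comm_monoidI)
  have add: "indets (p + q) \<subseteq> indets p \<union> indets q" for p q :: "('v, 'k) mpoly"
    using Poly_Mapping.keys_add[of p q] by (auto simp: indets_def)
  have mult: "indets (p * q) \<subseteq> indets p \<union> indets q" for p q :: "('v, 'k) mpoly"
  proof
    fix x assume "x \<in> indets (p * q)"
    then obtain t where t: "t \<in> Poly_Mapping.keys (p * q)" "x \<in> Poly_Mapping.keys t"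
      by (auto simp: indets_def)
    then obtain a b where "t = a + b" "a \<in> Poly_Mapping.keys p" "b \<in> Poly_Mapping.keys q"
      using Poly_Mapping.keys_mult[of p q] by blast
    thus "x \<in> indets p \<union> indets q"
      using t Poly_Mapping.keys_add[of a b] by (fastforce simp: indets_def)
  qed
  let ?R = "poly_ring V :: ('v, 'k) mpoly ring"
  show "p \<oplus>\<^bsub>?R\<^esub> q \<in> carrier ?R" if "p \<in> carrier ?R" "q \<in> carrier ?R" for p q
    using that add[of p q] by (auto simp: poly_ring_def)
  show "p \<otimes>\<^bsub>?R\<^esub> q \<in> carrier ?R" if "p \<in> carrier ?R" "q \<in> carrier ?R" for p q
    using that mult[of p q] by (auto simp: poly_ring_def)
  show "\<zero>\<^bsub>?R\<^esub> \<in> carrier ?R" "\<one>\<^bsub>?R\<^esub> \<in> carrier ?R"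
    by (auto simp: poly_ring_def indets_def)
  show "\<exists>q \<in> carrier ?R. q \<oplus>\<^bsub>?R\<^esub> p = \<zero>\<^bsub>?R\<^esub>" if "p \<in> carrier ?R" for p
    using that by (intro bexI[of _ "- p"]) (auto simp: poly_ring_def indets_def)
qed (auto simp: poly_ring_def algebra_simps)


section \<open>Edge ideals and square-free powers\<close>

definition edge_ideal :: "'v graph \<Rightarrow> ('v, 'k::field) mpoly set" where
  "edge_ideal G =
     Idl\<^bsub>poly_ring (verts G)\<^esub> {indet x * indet y | x y. {x, y} \<in> edges G}"

text \<open>The power \<open>I\<^sup>k\<close> of an ideal is the power in the monoid of ideals of \<open>R\<close> under the
  ideal product.\<close>

definition squarefree_power :: "'v graph \<Rightarrow> nat \<Rightarrow> ('v, 'k::field) mpoly set" where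
  "squarefree_power G k =
     (let R = poly_ring (verts G)
      in Idl\<^bsub>R\<^esub> {p \<in> edge_ideal G [^]\<^bsub>ideals_set R\<^esub> k. squarefree_monomial p})"


section \<open>Regular sequences and depth\<close>

definition quot_module :: "('a, 'b) ring_scheme \<Rightarrow> 'a set \<Rightarrow> ('a, 'a set) module" where
  "quot_module R I =
     ring.extend (R Quot I) (module.fields (\<lambda>r C. (I +>\<^bsub>R\<^esub> r) \<otimes>\<^bsub>R Quot I\<^esub> C))"

lemma module_quot_module:
  assumes "cring R" "ideal I R"
  shows "module R (quot_module R I)"
proof -
  interpret R: cring R by fact
  interpret I: ideal I R by fact
  interpret Q: cring "R Quot I"
    using I.quotient_is_cring assms by blast
  interpret h: ring_hom_ring R "R Quot I" "(+>\<^bsub>R\<^esub>) I"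
    by (rule I.rcos_ring_hom_ring)
  have sel: "carrier (quot_module R I) = carrier (R Quot I)"
    "monoid.mult (quot_module R I) = monoid.mult (R Quot I)" "one (quot_module R I) = one (R Quot I)"
    "ring.zero (quot_module R I) = ring.zero (R Quot I)" "add (quot_module R I) = add (R Quot I)"
    "smult (quot_module R I) = (\<lambda>r C. (I +>\<^bsub>R\<^esub> r) \<otimes>\<^bsub>R Quot I\<^esub> C)"
    by (simp_all add: quot_module_def ring.extend_def module.fields_def)
  show ?thesis
  proof (rule moduleI[OF assms(1)])
    show "abelian_group (quot_module R I)"
    proof (rule abelian_groupI)
      fix C assume "C \<in> carrier (quot_module R I)"
      thus "\<exists>D \<in> carrier (quot_module R I). D \<oplus>\<^bsub>quot_module R I\<^esub> C = \<zero>\<^bsub>quot_module R I\<^esub>"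
        by (intro bexI[of _ "\<ominus>\<^bsub>R Quot I\<^esub> C"]) (simp_all add: sel Q.l_neg)
    qed (simp_all add: sel Q.a_assoc Q.a_comm Q.a_lcomm)
  qed (simp_all add: sel Q.l_distr Q.r_distr Q.m_assoc)
qed

text \<open>The submodule \<open>F M\<close> of \<open>M\<close> generated by all \<open>f u\<close> with \<open>f \<in> F\<close> and \<open>u \<in> M\<close>; it equals
  \<open>(F) M\<close> for the ideal \<open>(F)\<close> generated by \<open>F\<close>.\<close>

definition times_module ::
    "('a, 'b) ring_scheme \<Rightarrow> 'a set \<Rightarrow> ('a, 'c, 'd) module_scheme \<Rightarrow> 'c set" where
  "times_module R F M =
     \<Inter>{N. submodule N R M \<and> (\<forall>f \<in> F. \<forall>u \<in> carrier M. f \<odot>\<^bsub>M\<^esub> u \<in> N)}"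

text \<open>\<open>f\<^sub>1, \<dots>, f\<^sub>r\<close> is \<open>M\<close>-regular if \<open>f\<^sub>i\<close> is a nonzerodivisor on
  \<open>M / (f\<^sub>1, \<dots>, f\<^bsub>i-1\<^esub>) M\<close> for all \<open>i\<close>, and \<open>M \<noteq> (f\<^sub>1, \<dots>, f\<^sub>r) M\<close>.\<close>

definition regular_sequence ::
    "('a, 'b) ring_scheme \<Rightarrow> ('a, 'c, 'd) module_scheme \<Rightarrow> 'a list \<Rightarrow> bool" where
  "regular_sequence R M fs \<longleftrightarrow>
     set fs \<subseteq> carrier R \<and>
     (\<forall>i < length fs. \<forall>u \<in> carrier M.
        fs ! i \<odot>\<^bsub>M\<^esub> u \<in> times_module R (set (take i fs)) M \<longrightarrow>
        u \<in> times_module R (set (take i fs)) M) \<and>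
     times_module R (set fs) M \<noteq> carrier M"

text \<open>The supremum of the lengths of \<open>M\<close>-regular sequences in an ideal \<open>\<aa>\<close>, with the usual
  convention that it is \<open>\<infinity>\<close> if \<open>\<aa> M = M\<close>.\<close>

definition grade ::
    "('a, 'b) ring_scheme \<Rightarrow> 'a set \<Rightarrow> ('a, 'c, 'd) module_scheme \<Rightarrow> enat" where
  "grade R \<aa> M =
     (if times_module R \<aa> M = carrier M then \<infinity>
      else (SUP fs \<in> {fs. regular_sequence R M fs \<and> set fs \<subseteq> \<aa>}. enat (length fs)))"

text \<open>For a finitely generated graded module over a polynomial ring, depth is taken with
  respect to the homogeneous maximal ideal generated by the indeterminates. The sequences
  may be arbitrary, not necessarily homogeneous.\<close>

definition depth ::
    "'v set \<Rightarrow> (('v, 'k::field) mpoly, 'c, 'd) module_scheme \<Rightarrow> enat" where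
  "depth V M = grade (poly_ring V) (Idl\<^bsub>poly_ring V\<^esub> (indet ` V)) M"

end

theory Submission
  imports Defs
begin

text \<open>The bound is the inequality \<open>depth \<le> dim\<close>, proved by counting monomials. The monomials in
  a regular sequence of length \<open>r\<close> on \<open>R/I\<close> are linearly independent over \<open>K\<close> modulo \<open>I\<close>: dividing
  a relation by the highest power of the first (nonzerodivisor) element and reducing modulo that
  element gives a shorter relation for the remaining sequence. Hence \<open>R/I\<close> grows at least like
  \<open>n\<^sup>r\<close>, whereas the monomials outside \<open>I\<close> grow like \<open>n\<^sup>d\<close>, with \<open>d\<close> the largest support of such a
  monomial. For \<open>I(W(C\<^sub>m))\<^bsup>[k]\<^esup>\<close> a monomial outside the ideal contains fewer than \<open>k\<close> whiskers
  \<open>{x\<^sub>i, y\<^sub>i}\<close> in its support, so \<open>d \<le> m + k - 1\<close>.\<close>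

section \<open>Submodules of a quotient ring\<close>

lemma quot_module_sel:
  "carrier (quot_module R I) = carrier (R Quot I)"
  "monoid.mult (quot_module R I) = monoid.mult (R Quot I)"
  "one (quot_module R I) = one (R Quot I)"
  "ring.zero (quot_module R I) = ring.zero (R Quot I)"
  "add (quot_module R I) = add (R Quot I)"
  "smult (quot_module R I) = (\<lambda>r C. (I +>\<^bsub>R\<^esub> r) \<otimes>\<^bsub>R Quot I\<^esub> C)"
  by (simp_all add: quot_module_def ring.extend_def module.fields_def)

lemma zero_quot_module: "\<zero>\<^bsub>quot_module R I\<^esub> = I"
  by (simp add: quot_module_sel FactRing_def)

lemma times_module_mono:
  assumes "F \<subseteq> F'"
  shows "times_module R F M \<subseteq> times_module R F' M"
  using assms unfolding times_module_def by (intro Inter_anti_mono) blast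

context cring
begin

lemma carrier_quot_module: "carrier (quot_module R I) = (+>) I ` carrier R"
  by (auto simp: quot_module_sel FactRing_def A_RCOSETS_def')

text \<open>\<open>J\<close> is the preimage in \<open>R\<close> of \<open>F (R/I)\<close>,
  classically \<open>I + (F)\<close>. It turns regularity on the quotient module into statements
  about ideals of \<open>R\<close>; the three properties serve to build a chain of ideals from a
  regular sequence.\<close>

lemma ideal_times_module_preimage:
  assumes I: "ideal I R" and F: "F \<subseteq> carrier R"
  defines "J \<equiv> {r \<in> carrier R. I +> r \<in> times_module R F (quot_module R I)}"
  shows "ideal J R" and "I \<subseteq> J" and "F \<subseteq> J"
proof -
  interpret I: ideal I R by fact
  interpret M: module R "quot_module R I"
    using module_quot_module I is_cring by blast
  interpret h: ring_hom_ring R "R Quot I" "(+>) I"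
    by (rule I.rcos_ring_hom_ring)
  have sub: "I +> r \<in> carrier (quot_module R I)" if "r \<in> carrier R" for r
    using that by (simp add: carrier_quot_module)
  let ?S = "{N. submodule N R (quot_module R I) \<and>
               (\<forall>f \<in> F. \<forall>u \<in> carrier (quot_module R I). f \<odot>\<^bsub>quot_module R I\<^esub> u \<in> N)}"
  have J: "r \<in> J \<longleftrightarrow> r \<in> carrier R \<and> (\<forall>N\<in>?S. I +> r \<in> N)" for r
    by (auto simp: J_def times_module_def)
  have zero: "I +> r \<in> N" if "r \<in> I" "N \<in> ?S" for r N
  proof -
    have "submodule N R (quot_module R I)" using that(2) by blast
    hence "\<one>\<^bsub>add_monoid (quot_module R I)\<^esub> \<in> N"
      by (intro subgroup.one_closed submodule.axioms(1))
    moreover have "I +> r = I" by (rule I.a_rcos_const[OF that(1)])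
    ultimately show ?thesis by (simp only: monoid.simps zero_quot_module)
  qed
  show "I \<subseteq> J"
    using zero I.Icarr by (auto simp: J)
  have smult: "x \<otimes> a \<in> J" if "a \<in> J" "x \<in> carrier R" for a x
  proof -
    have "I +> (x \<otimes> a) \<in> N" if "N \<in> ?S" for N
    proof -
      have "x \<odot>\<^bsub>quot_module R I\<^esub> (I +> a) \<in> N"
        using that \<open>a \<in> J\<close> \<open>x \<in> carrier R\<close> M.submoduleE(4) by (simp add: J)
      thus ?thesis
        using \<open>a \<in> J\<close> \<open>x \<in> carrier R\<close> by (simp add: J quot_module_sel)
    qed
    thus ?thesis using that by (simp add: J)
  qed
  have add: "a \<oplus> b \<in> J" if "a \<in> J" "b \<in> J" for a b
  proof -
    have "I +> (a \<oplus> b) \<in> N" if "N \<in> ?S" for N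
    proof -
      have "(I +> a) \<oplus>\<^bsub>quot_module R I\<^esub> (I +> b) \<in> N"
        using that \<open>a \<in> J\<close> \<open>b \<in> J\<close> M.submoduleE(5) by (simp add: J)
      thus ?thesis
        using \<open>a \<in> J\<close> \<open>b \<in> J\<close> by (simp add: J quot_module_sel)
    qed
    thus ?thesis using that by (simp add: J)
  qed
  show "ideal J R"
  proof (rule idealI[OF ring_axioms])
    show "subgroup J (add_monoid R)"
    proof (rule group.subgroupI)
      show "J \<noteq> {}" using \<open>I \<subseteq> J\<close> I.zero_closed by blast
      show "inv\<^bsub>add_monoid R\<^esub> a \<in> J" if "a \<in> J" for a
      proof -
        have "\<ominus> a = (\<ominus> \<one>) \<otimes> a" using that by (simp add: J l_minus)
        thus ?thesis using smult[of a "\<ominus> \<one>"] that by (simp add: a_inv_def)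
      qed
    qed (use add in \<open>auto simp: J a_group\<close>)
    show "x \<otimes> a \<in> J" "a \<otimes> x \<in> J" if "a \<in> J" "x \<in> carrier R" for a x
      using smult that m_comm by (auto simp: J)
  qed
  show "F \<subseteq> J"
  proof
    fix f assume f: "f \<in> F"
    have "I +> f \<in> N" if "N \<in> ?S" for N
    proof -
      have "f \<odot>\<^bsub>quot_module R I\<^esub> (I +> \<one>) \<in> N"
        using that f sub by blast
      moreover have "(I +> f) \<otimes>\<^bsub>R Quot I\<^esub> (I +> \<one>) = I +> f"
        using f F h.hom_mult[of f \<one>] by auto
      ultimately show ?thesis by (simp add: quot_module_sel)
    qed
    thus "f \<in> J" using f F by (auto simp: J)
  qed
qed

text \<open>The image of \<open>A\<close> in \<open>R/I\<close> is a submodule containing all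
  \<open>f u\<close> with \<open>f \<in> A\<close>, and it misses the class of \<open>1\<close>
  because \<open>I \<subseteq> A\<close>. This excludes the value \<open>\<infinity>\<close> in
  \<open>grade\<close>.\<close>

lemma times_module_quot_proper:
  assumes I: "ideal I R" and A: "ideal A R" and "I \<subseteq> A" "\<one> \<notin> A"
  shows "times_module R A (quot_module R I) \<noteq> carrier (quot_module R I)"
proof -
  interpret I: ideal I R by fact
  interpret A: ideal A R by fact
  interpret M: module R "quot_module R I"
    using module_quot_module I is_cring by blast
  interpret h: ring_hom_ring R "R Quot I" "(+>) I"
    by (rule I.rcos_ring_hom_ring)
  have "submodule ((+>) I ` A) R (quot_module R I)"
  proof (rule M.submoduleI)
    show "(+>) I ` A \<subseteq> carrier (quot_module R I)"
      using A.Icarr by (auto simp: carrier_quot_module)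
    show "\<zero>\<^bsub>quot_module R I\<^esub> \<in> (+>) I ` A"
      unfolding zero_quot_module
      by (rule image_eqI[where x = "\<zero>", OF I.a_rcos_const[symmetric]])
        (rule I.zero_closed A.zero_closed)+
    show add: "a \<oplus>\<^bsub>quot_module R I\<^esub> b \<in> (+>) I ` A" if ab: "a \<in> (+>) I ` A" "b \<in> (+>) I ` A" for a b
    proof -
      obtain x y where xy: "x \<in> A" "y \<in> A" "a = I +> x" "b = I +> y"
        using ab by blast
      hence "a \<oplus>\<^bsub>quot_module R I\<^esub> b = I +> (x \<oplus> y)"
        using A.Icarr by (simp add: quot_module_sel)
      thus ?thesis using xy by blast
    qed
    show smult: "x \<odot>\<^bsub>quot_module R I\<^esub> a \<in> (+>) I ` A"
      if xa: "x \<in> carrier R" "a \<in> (+>) I ` A" for a x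
    proof -
      obtain y where y: "y \<in> A" "a = I +> y"
        using xa by blast
      hence "x \<odot>\<^bsub>quot_module R I\<^esub> a = I +> (x \<otimes> y)"
        using A.Icarr xa by (simp add: quot_module_sel)
      thus ?thesis using y xa A.I_l_closed by blast
    qed
    show "\<ominus>\<^bsub>quot_module R I\<^esub> a \<in> (+>) I ` A" if "a \<in> (+>) I ` A" for a
    proof -
      have "a \<in> carrier (quot_module R I)"
        using that A.Icarr by (auto simp: carrier_quot_module)
      hence "\<ominus>\<^bsub>quot_module R I\<^esub> a = (\<ominus> \<one>) \<odot>\<^bsub>quot_module R I\<^esub> a"
        by (simp add: M.smult_l_minus)
      thus ?thesis using smult[of "\<ominus> \<one>" a] that by simp
    qed
  qed
  moreover have "f \<odot>\<^bsub>quot_module R I\<^esub> u \<in> (+>) I ` A"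
    if f: "f \<in> A" and u: "u \<in> carrier (quot_module R I)" for f u
  proof -
    obtain x where "x \<in> carrier R" "u = I +> x"
      using u by (auto simp: carrier_quot_module)
    moreover from this have "f \<odot>\<^bsub>quot_module R I\<^esub> u = I +> (f \<otimes> x)"
      using f A.Icarr by (simp add: quot_module_sel)
    ultimately show ?thesis using f A.I_r_closed by blast
  qed
  ultimately have sub: "times_module R A (quot_module R I) \<subseteq> (+>) I ` A"
    unfolding times_module_def by (intro Inter_lower) blast
  have "I +> \<one> \<notin> (+>) I ` A"
  proof
    assume "I +> \<one> \<in> (+>) I ` A"
    then obtain a where a: "a \<in> A" "I +> \<one> = I +> a" by blast
    hence "\<one> \<in> I +> a" using I.a_rcos_self[OF one_closed] by simp
    then obtain i where "i \<in> I" "\<one> = i \<oplus> a" by (auto simp: a_r_coset_def')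
    hence "\<one> \<in> A" using a \<open>I \<subseteq> A\<close> A.a_closed by auto
    thus False using \<open>\<one> \<notin> A\<close> by simp
  qed
  moreover have "I +> \<one> \<in> carrier (quot_module R I)"
    unfolding carrier_quot_module by (rule imageI) simp
  ultimately show ?thesis using sub by blast
qed

end

section \<open>Closure of polynomial carriers and arithmetic in their ideals\<close>

lemma poly_ring_sel [simp]:
  "monoid.mult (poly_ring V) = (*)" "one (poly_ring V) = 1"
  "ring.zero (poly_ring V) = 0" "add (poly_ring V) = (+)"
  by (simp_all add: poly_ring_def)

lemma carrier_poly_ring: "p \<in> carrier (poly_ring V) \<longleftrightarrow> indets p \<subseteq> V"
  by (simp add: poly_ring_def)

lemma carrier_poly_ring_add:
  "p \<in> carrier (poly_ring V) \<Longrightarrow> q \<in> carrier (poly_ring V) \<Longrightarrow> p + q \<in> carrier (poly_ring V)"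
  using ring.ring_simprules(1)[OF cring.axioms(1)[OF cring_poly_ring], of p V q] by simp

lemma carrier_poly_ring_mult:
  "p \<in> carrier (poly_ring V) \<Longrightarrow> q \<in> carrier (poly_ring V) \<Longrightarrow> p * q \<in> carrier (poly_ring V)"
  using ring.ring_simprules(5)[OF cring.axioms(1)[OF cring_poly_ring], of p V q] by simp

lemma carrier_poly_ring_single:
  "Poly_Mapping.keys t \<subseteq> V \<Longrightarrow> Poly_Mapping.single t c \<in> carrier (poly_ring V)"
  by (auto simp: carrier_poly_ring indets_def)

lemma carrier_poly_ring_0_1:
  "0 \<in> carrier (poly_ring V)" "1 \<in> carrier (poly_ring V)"
  by (auto simp: carrier_poly_ring indets_def)

lemma carrier_poly_ring_power:
  "p \<in> carrier (poly_ring V) \<Longrightarrow> p ^ n \<in> carrier (poly_ring V)"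
  by (induction n) (simp_all add: carrier_poly_ring_mult carrier_poly_ring_0_1)

lemma carrier_poly_ring_sum:
  "(\<And>a. a \<in> A \<Longrightarrow> g a \<in> carrier (poly_ring V)) \<Longrightarrow> sum g A \<in> carrier (poly_ring V)"
  by (induction A rule: infinite_finite_induct) (simp_all add: carrier_poly_ring_add carrier_poly_ring_0_1)

lemmas carrier_poly_ring_closed =
  carrier_poly_ring_add carrier_poly_ring_mult carrier_poly_ring_single carrier_poly_ring_0_1
  carrier_poly_ring_power carrier_poly_ring_sum

context
  fixes J :: "('v, 'k::field) mpoly set" and V :: "'v set"
  assumes J: "ideal J (poly_ring V)"
begin

interpretation J: ideal J "poly_ring V" by (rule J)

lemma poly_ideal_add: "p \<in> J \<Longrightarrow> q \<in> J \<Longrightarrow> p + q \<in> J"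
  using additive_subgroup.a_closed[OF J.additive_subgroup_axioms] by simp

lemma poly_ideal_mult: "p \<in> carrier (poly_ring V) \<Longrightarrow> q \<in> J \<Longrightarrow> p * q \<in> J"
  using J.I_l_closed by simp

lemma poly_ideal_0: "0 \<in> J"
  using additive_subgroup.zero_closed[OF J.additive_subgroup_axioms] by simp

lemma poly_ideal_sum: "(\<And>a. a \<in> A \<Longrightarrow> g a \<in> J) \<Longrightarrow> sum g A \<in> J"
  by (induction A rule: infinite_finite_induct) (simp_all add: poly_ideal_add poly_ideal_0)

lemma poly_ideal_diff:
  assumes "p \<in> J" "q \<in> J" shows "p - q \<in> J"
proof -
  have "Poly_Mapping.single 0 (- 1) * q \<in> J"
    using assms by (intro poly_ideal_mult) (auto intro: carrier_poly_ring_single)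
  moreover have "Poly_Mapping.single 0 (- 1) * q = - q"
    by (simp add: single_uminus)
  ultimately show ?thesis using poly_ideal_add[of p "- q"] assms by simp
qed

end

section \<open>Monomials in a regular sequence are linearly independent\<close>

text \<open>The recursion is on the elements alone and reads exponents with \<open>hd\<close> and
  \<open>tl\<close>; the value is meaningful for lists of equal length.\<close>

primrec list_monom :: "'a::comm_monoid_mult list \<Rightarrow> nat list \<Rightarrow> 'a" where
  "list_monom [] es = 1"
| "list_monom (f # fs) es = f ^ hd es * list_monom fs (tl es)"

lemma carrier_list_monom:
  "set fs \<subseteq> carrier (poly_ring V) \<Longrightarrow> list_monom fs es \<in> carrier (poly_ring V)"
  by (induction fs arbitrary: es) (simp_all add: carrier_poly_ring_closed)

text \<open>A box of exponent vectors rather than a bounded total degree: the count is exactly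
  \<open>(n + 1) ^ r\<close>, and the first exponent splits off freely.\<close>

definition exps :: "nat \<Rightarrow> nat \<Rightarrow> nat list set" where
  "exps n r = {es. set es \<subseteq> {..n} \<and> length es = r}"

lemma finite_exps: "finite (exps n r)" and card_exps: "card (exps n r) = (n + 1) ^ r"
  using finite_lists_length_eq[of "{..n}" r] card_lists_length_eq[of "{..n}" r]
  by (simp_all add: exps_def)

lemma sum_exps_Suc: "sum h (exps n (Suc r)) = (\<Sum>e\<le>n. \<Sum>es\<in>exps n r. h (e # es))"
proof -
  have "sum h (exps n (Suc r)) = (\<Sum>(e, es) \<in> {..n} \<times> exps n r. h (e # es))"
    by (rule sum.reindex_bij_witness[where i = "\<lambda>(e, es). e # es" and j = "\<lambda>es. (hd es, tl es)"])
      (auto simp: exps_def length_Suc_conv)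
  thus ?thesis by (simp add: sum.cartesian_product)
qed

text \<open>As \<open>f\<close> is a nonzerodivisor modulo \<open>J\<close>, a relation \<open>\<Sum> f\<^sup>e G\<^sub>e \<in> J\<close> with
  \<open>G\<^sub>0 = 0\<close> can be divided by \<open>f\<close>.\<close>

lemma regular_element_coeffs_zero:
  fixes J J' :: "('v, 'k::field) mpoly set"
  assumes J: "ideal J (poly_ring V)" and J': "ideal J' (poly_ring V)" and "J \<subseteq> J'"
    and f: "f \<in> carrier (poly_ring V)" "f \<in> J'"
    and reg: "\<And>u. u \<in> carrier (poly_ring V) \<Longrightarrow> f * u \<in> J \<Longrightarrow> u \<in> J"
    and G: "\<And>e. e \<le> n \<Longrightarrow> G e \<in> carrier (poly_ring V)"
      "\<And>e. e \<le> n \<Longrightarrow> G e \<in> J' \<Longrightarrow> G e = 0"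
    and "(\<Sum>e\<le>n. f ^ e * G e) \<in> J" and "e \<le> n"
  shows "G e = 0"
  using G assms(9,10)
proof (induction n arbitrary: G e)
  case 0
  thus ?case using \<open>J \<subseteq> J'\<close> by auto
next
  case (Suc n)
  \<comment> \<open>What remains of the relation once the zeroth term is removed and one factor
    \<open>f\<close> is taken out.\<close>
  define H where "H = (\<Sum>e\<le>n. f ^ e * G (Suc e))"
  have H: "H \<in> carrier (poly_ring V)"
    using Suc.prems f unfolding H_def by (intro carrier_poly_ring_closed) auto
  have eq: "(\<Sum>e\<le>Suc n. f ^ e * G e) = G 0 + f * H"
    by (subst sum.atMost_Suc_shift) (simp add: H_def sum_distrib_left mult.assoc)
  \<comment> \<open>Reducing modulo \<open>J'\<close>, which contains \<open>f\<close>, isolates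
    \<open>G 0\<close>.\<close>
  have "G 0 + f * H \<in> J'"
    using Suc.prems(3) \<open>J \<subseteq> J'\<close> unfolding eq by blast
  moreover have "f * H \<in> J'"
    using poly_ideal_mult[OF J' H f(2)] by (simp add: mult.commute)
  ultimately have "G 0 \<in> J'"
    using poly_ideal_diff[OF J', of "G 0 + f * H" "f * H"] by simp
  hence G0: "G 0 = 0" using Suc.prems(2)[of 0] by simp
  hence "H \<in> J"
    using Suc.prems(3) reg[OF H] unfolding eq by simp
  hence "G (Suc e) = 0" if "e \<le> n" for e
    using Suc.IH[of "\<lambda>e. G (Suc e)" e] Suc.prems(1,2) that unfolding H_def by simp
  thus ?case using G0 Suc.prems(4) by (cases e) auto
qed

text \<open>\<open>J i\<close> plays the role of \<open>I + (f_1, ..., f_i)\<close>. For an abstract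
  chain, removing the first element is just a shift, so induction on the list applies.
  \<open>regular_element_coeffs_zero\<close> handles the first element; its vanishing condition on
  the coefficients comes from the induction hypothesis.\<close>

lemma regular_chain_independent:
  fixes J :: "nat \<Rightarrow> ('v, 'k::field) mpoly set"
  assumes "\<And>i. i \<le> length fs \<Longrightarrow> ideal (J i) (poly_ring V)"
    and "\<And>i. i < length fs \<Longrightarrow> J i \<subseteq> J (Suc i)"
    and "\<And>i. i < length fs \<Longrightarrow> fs ! i \<in> J (Suc i)"
    and "\<And>i u. i < length fs \<Longrightarrow> u \<in> carrier (poly_ring V) \<Longrightarrow> fs ! i * u \<in> J i \<Longrightarrow> u \<in> J i"
    and "1 \<notin> J (length fs)" and "set fs \<subseteq> carrier (poly_ring V)"
    and "(\<Sum>es\<in>exps n (length fs). Poly_Mapping.single 0 (c es) * list_monom fs es) \<in> J 0"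
    and "es \<in> exps n (length fs)"
  shows "c es = 0"
  using assms
proof (induction fs arbitrary: J c es)
  case Nil
  have "exps n 0 = {[]}" by (auto simp: exps_def)
  with Nil have c: "Poly_Mapping.single 0 (c []) \<in> J 0" and es: "es = []" by auto
  show ?case
  proof (rule ccontr)
    assume "c es \<noteq> 0"
    \<comment> \<open>A nonzero constant in \<open>J 0\<close> can be scaled to
      \<open>1\<close>.\<close>
    moreover have "Poly_Mapping.single 0 (inverse (c [])) * Poly_Mapping.single 0 (c []) \<in> J 0"
      using c Nil.prems(1)[of 0]
      by (intro poly_ideal_mult[of "J 0" V]) (auto intro: carrier_poly_ring_single)
    ultimately show False using Nil.prems(5) es by (simp add: mult_single)
  qed
next
  case (Cons f fs)
  \<comment> \<open>The coefficient of \<open>f ^ e\<close> when the relation is grouped by powers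
    of \<open>f\<close>.\<close>
  define G where "G e = (\<Sum>es\<in>exps n (length fs). Poly_Mapping.single 0 (c (e # es)) * list_monom fs es)" for e
  \<comment> \<open>The tail of the sequence with the shifted chain, whose starting ideal is
    \<open>J 1\<close>.\<close>
  have IH: "c (e # es) = 0" if "G e \<in> J 1" "es \<in> exps n (length fs)" for e es
  proof (rule Cons.IH[of "\<lambda>i. J (Suc i)" "\<lambda>es. c (e # es)" es])
    show "u \<in> J (Suc i)"
      if "i < length fs" "u \<in> carrier (poly_ring V)" "fs ! i * u \<in> J (Suc i)" for i u
      using Cons.prems(4)[of "Suc i" u] that by simp
  qed (use that Cons.prems(1-3)[of "Suc _"] Cons.prems(5,6) in \<open>auto simp: G_def\<close>)
  obtain e es' where es: "es = e # es'" "e \<le> n" "es' \<in> exps n (length fs)"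
    using Cons.prems(8) by (auto simp: exps_def length_Suc_conv)
  have "G e = 0"
  proof (rule regular_element_coeffs_zero[where J = "J 0" and J' = "J 1" and f = f and n = n and G = G])
    show "(\<Sum>e\<le>n. f ^ e * G e) \<in> J 0"
    proof -
      have "(\<Sum>e\<le>n. f ^ e * G e) =
          (\<Sum>es\<in>exps n (length (f # fs)). Poly_Mapping.single 0 (c es) * list_monom (f # fs) es)"
        by (simp add: sum_exps_Suc G_def sum_distrib_left mult_ac)
      thus ?thesis using Cons.prems(7) by simp
    qed
    show "G e \<in> carrier (poly_ring V)" for e
      unfolding G_def using Cons.prems(6) carrier_list_monom[of fs V]
      by (intro carrier_poly_ring_closed) auto
    show "G e = 0" if "G e \<in> J 1" for e
      unfolding G_def using IH[OF that] by (intro sum.neutral) simp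
    show "ideal (J 0) (poly_ring V)" "ideal (J 1) (poly_ring V)"
      using Cons.prems(1)[of 0] Cons.prems(1)[of 1] by auto
    show "J 0 \<subseteq> J 1" "f \<in> J 1" using Cons.prems(2,3)[of 0] by auto
    show "u \<in> J 0" if "u \<in> carrier (poly_ring V)" "f * u \<in> J 0" for u
      using Cons.prems(4)[of 0 u] that by simp
  qed (use Cons.prems(6) es in auto)
  \<comment> \<open>Since \<open>G e = 0\<close> lies in \<open>J 1\<close>, \<open>IH\<close> now
    kills the individual coefficients.\<close>
  moreover have "0 \<in> J 1" using Cons.prems(1)[of 1] by (intro poly_ideal_0[of "J 1" V]) simp
  ultimately show ?case using IH[of e es'] es by simp
qed

section \<open>Counting standard monomials\<close>

lemma poly_mapping_sum_single:
  "p = (\<Sum>t\<in>Poly_Mapping.keys p. Poly_Mapping.single t (Poly_Mapping.lookup p t))"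
proof (rule poly_mapping_eqI)
  fix s
  show "Poly_Mapping.lookup p s = Poly_Mapping.lookup
      (\<Sum>t\<in>Poly_Mapping.keys p. Poly_Mapping.single t (Poly_Mapping.lookup p t)) s"
    by (cases "s \<in> Poly_Mapping.keys p")
      (auto simp: lookup_sum lookup_single when_def in_keys_iff sum.delta)
qed

text \<open>Scalars act as constant polynomials, which matches the form of the relations above and
  makes the comparison of independent with spanning sets available.\<close>

interpretation mpoly: vector_space
  "\<lambda>c (p :: ('v, 'k::field) mpoly). Poly_Mapping.single 0 c * p"
  by standard (simp_all add: algebra_simps single_add mult_single flip: mult.assoc)

text \<open>Independence of an indexed family forces \<open>w\<close> to be injective, so its image
  has \<open>card A\<close> elements and is bounded by the spanning set.\<close>

lemma mpoly_card_le_of_independent: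
  fixes w :: "'a \<Rightarrow> ('v, 'k::field) mpoly"
  assumes "finite A" "finite B" and span: "\<And>a. a \<in> A \<Longrightarrow> w a \<in> mpoly.span B"
    and indep: "\<And>c a. (\<Sum>a\<in>A. Poly_Mapping.single 0 (c a) * w a) = 0 \<Longrightarrow> a \<in> A \<Longrightarrow> c a = 0"
  shows "card A \<le> card B"
proof -
  have inj: "inj_on w A"
  proof (rule inj_onI, rule ccontr)
    fix a b assume ab: "a \<in> A" "b \<in> A" "w a = w b" "a \<noteq> b"
    \<comment> \<open>Coefficients \<open>1\<close> and \<open>-1\<close> at two indices with equal
      vectors give a nontrivial relation.\<close>
    define c :: "'a \<Rightarrow> 'k" where "c x = (if x = a then 1 else if x = b then - 1 else 0)" for x
    have "(\<Sum>x\<in>A. Poly_Mapping.single 0 (c x) * w x) = (\<Sum>x\<in>{a, b}. Poly_Mapping.single 0 (c x) * w x)"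
      using ab \<open>finite A\<close> by (intro sum.mono_neutral_right) (auto simp: c_def)
    also have "\<dots> = 0" using ab by (simp add: c_def single_uminus)
    finally have "c a = 0" using indep ab by blast
    thus False by (simp add: c_def)
  qed
  have "mpoly.independent (w ` A)"
    unfolding mpoly.dependent_finite[OF finite_imageI[OF \<open>finite A\<close>]]
    using indep[of "\<lambda>a. _ (w a)"] by (auto simp: sum.reindex[OF inj])
  hence "card (w ` A) \<le> card B"
    using mpoly.independent_span_bound[OF \<open>finite B\<close>, of "w ` A"] span by blast
  thus ?thesis using card_image[OF inj] by simp
qed

text \<open>Terms of \<open>p\<close> whose monomial lies in \<open>I\<close> may be discarded
  modulo \<open>I\<close>. As \<open>w\<close> uses only keys of \<open>p\<close>, bounds on the
  exponents of \<open>p\<close> carry over.\<close>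

lemma mod_ideal_standard_monomials:
  fixes I :: "('v, 'k::field) mpoly set"
  assumes I: "ideal I (poly_ring V)" and p: "p \<in> carrier (poly_ring V)"
  obtains w where "w \<in> mpoly.span (monomial ` {t \<in> Poly_Mapping.keys p. monomial t \<notin> I})" "p - w \<in> I"
proof
  let ?s = "\<lambda>t. Poly_Mapping.single t (Poly_Mapping.lookup p t)"
  let ?G = "{t \<in> Poly_Mapping.keys p. (monomial t :: ('v, 'k) mpoly) \<notin> I}"
  have s: "?s t = Poly_Mapping.single 0 (Poly_Mapping.lookup p t) * monomial t" for t
    by (simp add: monomial_def mult_single)
  show "sum ?s ?G \<in> mpoly.span (monomial ` ?G)"
    unfolding s by (intro mpoly.span_sum mpoly.span_scale mpoly.span_base) blast
  have "p - sum ?s ?G = sum ?s (Poly_Mapping.keys p) - sum ?s ?G"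
    by (subst poly_mapping_sum_single[of p]) (rule refl)
  also have "\<dots> = sum ?s (Poly_Mapping.keys p - ?G)"
    by (intro sum_diff[symmetric]) auto
  also have "\<dots> \<in> I"
    unfolding s by (intro poly_ideal_sum[OF I] poly_ideal_mult[OF I] carrier_poly_ring_single) auto
  finally show "p - sum ?s ?G \<in> I" .
qed

section \<open>Counting exponent vectors and bounding exponents of products\<close>

lemma bounded_exponents:
  assumes "finite S"
  shows "finite {t. Poly_Mapping.keys t \<subseteq> S \<and> (\<forall>x. Poly_Mapping.lookup t x \<le> (N::nat))}" (is "finite ?T")
    and "card {t. Poly_Mapping.keys t \<subseteq> S \<and> (\<forall>x. Poly_Mapping.lookup t x \<le> N)} \<le> (N + 1) ^ card S"
proof -
  \<comment> \<open>Vectors supported in \<open>S\<close> vanish elsewhere, so restriction to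
    \<open>S\<close> is injective, and functions from \<open>S\<close> to \<open>{..N}\<close> can
    be counted instead.\<close>
  let ?f = "\<lambda>t. restrict (Poly_Mapping.lookup t) S"
  have "inj_on ?f ?T"
  proof (intro inj_onI poly_mapping_eqI)
    fix s t x assume st: "s \<in> ?T" "t \<in> ?T" "?f s = ?f t"
    show "Poly_Mapping.lookup s x = Poly_Mapping.lookup t x"
    proof (cases "x \<in> S")
      case True
      thus ?thesis using fun_cong[OF st(3), of x] by simp
    next
      case False
      hence "x \<notin> Poly_Mapping.keys s" "x \<notin> Poly_Mapping.keys t" using st by auto
      thus ?thesis by (simp add: in_keys_iff)
    qed
  qed
  moreover have "?f ` ?T \<subseteq> S \<rightarrow>\<^sub>E {..N}" by auto
  moreover have "finite (S \<rightarrow>\<^sub>E {..N})" using assms by (intro finite_PiE) auto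
  moreover have "card (S \<rightarrow>\<^sub>E {..N}) = (N + 1) ^ card S" using assms by (simp add: card_PiE)
  ultimately show "finite ?T" "card ?T \<le> (N + 1) ^ card S"
    using inj_on_finite[of ?f ?T "S \<rightarrow>\<^sub>E {..N}"] card_inj_on_le[of ?f ?T "S \<rightarrow>\<^sub>E {..N}"] by auto
qed

text \<open>There are at most \<open>2 ^ card V\<close> sets of at most \<open>d\<close> variables
  to serve as support, and each contributes at most \<open>(N + 1) ^ d\<close> vectors. Only the
  second factor grows with \<open>N\<close>.\<close>

lemma card_bounded_support_exponents:
  assumes V: "finite V"
  shows "finite {t. Poly_Mapping.keys t \<subseteq> V \<and> card (Poly_Mapping.keys t) \<le> d \<and>
      (\<forall>x. Poly_Mapping.lookup t x \<le> (N::nat))}" (is "finite ?T")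
    and "card {t. Poly_Mapping.keys t \<subseteq> V \<and> card (Poly_Mapping.keys t) \<le> d \<and>
      (\<forall>x. Poly_Mapping.lookup t x \<le> N)} \<le> 2 ^ card V * (N + 1) ^ d"
proof -
  let ?S = "{S \<in> Pow V. card S \<le> d}"
  let ?B = "\<lambda>S. {t. Poly_Mapping.keys t \<subseteq> S \<and> (\<forall>x. Poly_Mapping.lookup t x \<le> N)}"
  have S: "finite ?S" using V by simp
  have sub: "?T \<subseteq> (\<Union>S\<in>?S. ?B S)" by blast
  have finS: "finite S" if "S \<in> ?S" for S
    using that by (intro finite_subset[OF _ V]) blast
  have fin: "finite (\<Union>S\<in>?S. ?B S)"
    by (intro finite_UN_I[OF S] bounded_exponents(1) finS)
  thus "finite ?T" using sub finite_subset by blast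
  have "card ?T \<le> card (\<Union>S\<in>?S. ?B S)" using fin sub by (rule card_mono)
  also have "\<dots> \<le> (\<Sum>S\<in>?S. card (?B S))" using S by (rule card_UN_le)
  also have "\<dots> \<le> (\<Sum>S\<in>?S. (N + 1) ^ d)"
  proof (rule sum_mono)
    fix S assume "S \<in> ?S"
    hence "card (?B S) \<le> (N + 1) ^ card S" using bounded_exponents(2) finS by blast
    also have "\<dots> \<le> (N + 1) ^ d" using \<open>S \<in> ?S\<close> by (intro power_increasing) auto
    finally show "card (?B S) \<le> (N + 1) ^ d" .
  qed
  also have "\<dots> = card ?S * (N + 1) ^ d" by simp
  also have "card ?S \<le> card (Pow V)" using V by (intro card_mono) auto
  hence "card ?S * (N + 1) ^ d \<le> 2 ^ card V * (N + 1) ^ d" using V by (simp add: card_Pow)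
  finally show "card ?T \<le> 2 ^ card V * (N + 1) ^ d" .
qed

text \<open>Each exponent is bounded separately, which fits the box counts. The zero polynomial
  satisfies every bound.\<close>

definition exps_le :: "('v, 'k::zero) mpoly \<Rightarrow> nat \<Rightarrow> bool" where
  "exps_le p D \<longleftrightarrow> (\<forall>t\<in>Poly_Mapping.keys p. \<forall>x. Poly_Mapping.lookup t x \<le> D)"

lemma exps_le_ex: "\<exists>D. exps_le (p :: ('v, 'k::zero) mpoly) D"
proof -
  let ?K = "\<Union>t\<in>Poly_Mapping.keys p. Poly_Mapping.lookup t ` Poly_Mapping.keys t"
  \<comment> \<open>\<open>insert 0\<close> covers variables outside the support of \<open>t\<close>
    and keeps the set nonempty.\<close>
  have "Poly_Mapping.lookup t x \<le> Max (insert 0 ?K)" if "t \<in> Poly_Mapping.keys p" for t x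
    using that by (cases "x \<in> Poly_Mapping.keys t") (auto intro!: Max_ge simp: in_keys_iff)
  thus ?thesis unfolding exps_le_def by blast
qed

lemma exps_le_mult:
  assumes "exps_le p D" "exps_le q E"
  shows "exps_le (p * q :: ('v, 'k::field) mpoly) (D + E)"
  unfolding exps_le_def
proof (intro ballI allI)
  fix t x assume "t \<in> Poly_Mapping.keys (p * q)"
  then obtain a b where "t = a + b" "a \<in> Poly_Mapping.keys p" "b \<in> Poly_Mapping.keys q"
    using keys_mult[of p q] by blast
  thus "Poly_Mapping.lookup t x \<le> D + E"
    using assms by (simp add: exps_le_def lookup_add add_mono)
qed

lemma exps_le_mono: "exps_le p D \<Longrightarrow> D \<le> E \<Longrightarrow> exps_le p E"
  unfolding exps_le_def using order_trans by blast

lemma exps_le_one: "exps_le (1 :: ('v, 'k::field) mpoly) 0"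
  by (simp add: exps_le_def)

lemma exps_le_power:
  "exps_le p D \<Longrightarrow> exps_le (p ^ n :: ('v, 'k::field) mpoly) (n * D)"
  by (induction n) (simp_all add: exps_le_one exps_le_mult)

text \<open>The bound is linear in \<open>n\<close>, so the standard monomials involved number at
  most a constant times \<open>(n + 1) ^ d\<close>.\<close>

lemma exps_le_list_monom:
  assumes "\<And>f. f \<in> set fs \<Longrightarrow> exps_le (f :: ('v, 'k::field) mpoly) D" "es \<in> exps n (length fs)"
  shows "exps_le (list_monom fs es) (length fs * n * D)"
  using assms
proof (induction fs arbitrary: es)
  case Nil
  thus ?case by (simp add: exps_le_one)
next
  case (Cons f fs)
  obtain e es' where es: "es = e # es'" "e \<le> n" "es' \<in> exps n (length fs)"
    using Cons.prems(2) by (auto simp: exps_def length_Suc_conv)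
  have f: "exps_le (f ^ e) (n * D)"
    using Cons.prems(1) es(2) by (intro exps_le_mono[OF exps_le_power]) auto
  have fs: "exps_le (list_monom fs es') (length fs * n * D)"
    using Cons.IH Cons.prems es by auto
  show ?case
    using exps_le_mult[OF f fs] es by (simp add: algebra_simps)
qed

section \<open>Depth is bounded by dimension\<close>

text \<open>The abstract chain is instantiated with the preimages in \<open>R\<close> of the
  submodules \<open>(f_1, ..., f_i)(R/I)\<close>; regularity becomes cancellation modulo these
  ideals.\<close>

lemma regular_sequence_independent:
  fixes I :: "('v, 'k::field) mpoly set"
  assumes I: "ideal I (poly_ring V)"
    and reg: "regular_sequence (poly_ring V) (quot_module (poly_ring V) I) fs"
    and "(\<Sum>es\<in>exps n (length fs). Poly_Mapping.single 0 (c es) * list_monom fs es) \<in> I"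
    and "es \<in> exps n (length fs)"
  shows "c es = 0"
proof -
  define R where "R = (poly_ring V :: ('v, 'k) mpoly ring)"
  define J where "J i = {r \<in> carrier R. I +>\<^bsub>R\<^esub> r \<in> times_module R (set (take i fs)) (quot_module R I)}" for i
  interpret R: cring R unfolding R_def by (rule cring_poly_ring)
  interpret I: ideal I R using I by (simp add: R_def)
  interpret h: ring_hom_ring R "R Quot I" "(+>\<^bsub>R\<^esub>) I"
    by (rule I.rcos_ring_hom_ring)
  note reg = reg[folded R_def, unfolded regular_sequence_def]
  have take: "set (take i fs) \<subseteq> carrier R" for i
    using reg set_take_subset[of i fs] by blast
  note J = R.ideal_times_module_preimage[OF I.is_ideal take, folded J_def]
  have sel: "f \<odot>\<^bsub>quot_module R I\<^esub> (I +>\<^bsub>R\<^esub> u) = I +>\<^bsub>R\<^esub> (f * u)"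
    if "f \<in> carrier R" "u \<in> carrier R" for f u
    using h.hom_mult[OF that] unfolding quot_module_sel R_def by simp
  show ?thesis
  proof (rule regular_chain_independent[where J = J and V = V and n = n and fs = fs])
    show "ideal (J i) (poly_ring V)" for i
      using J(1) by (simp add: R_def)
    show "J i \<subseteq> J (Suc i)" for i
      using times_module_mono[of "set (take i fs)" "set (take (Suc i) fs)" R "quot_module R I"]
        set_take_subset_set_take[of i "Suc i" fs] by (auto simp: J_def)
    show "fs ! i \<in> J (Suc i)" if "i < length fs" for i
      using J(3)[of "Suc i"] that by (auto simp: take_Suc_conv_app_nth)
    show "u \<in> J i" if i: "i < length fs" and u: "u \<in> carrier (poly_ring V)" and fu: "fs ! i * u \<in> J i" for i u
    proof -
      have f: "fs ! i \<in> carrier R" using reg i nth_mem[OF i] by blast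
      have u': "u \<in> carrier R" using u by (simp add: R_def)
      have "fs ! i \<odot>\<^bsub>quot_module R I\<^esub> (I +>\<^bsub>R\<^esub> u) \<in> times_module R (set (take i fs)) (quot_module R I)"
        unfolding sel[OF f u'] using fu by (simp add: J_def)
      moreover have "I +>\<^bsub>R\<^esub> u \<in> carrier (quot_module R I)"
        unfolding R.carrier_quot_module using u' by blast
      ultimately have "I +>\<^bsub>R\<^esub> u \<in> times_module R (set (take i fs)) (quot_module R I)"
        using reg i by blast
      thus ?thesis using u' by (simp add: J_def)
    qed
    show "1 \<notin> J (length fs)"
    proof
      \<comment> \<open>This would make \<open>(f_1, ..., f_r)(R/I)\<close> the whole quotient,
        against the last clause of \<open>regular_sequence\<close>.\<close>
      assume "1 \<in> J (length fs)"
      hence "\<one>\<^bsub>R\<^esub> \<in> J (length fs)" by (simp add: R_def)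
      hence "carrier R = J (length fs)"
        using ideal.one_imp_carrier[OF J(1)] by simp
      hence "carrier (quot_module R I) \<subseteq> times_module R (set fs) (quot_module R I)"
        unfolding R.carrier_quot_module J_def by auto
      moreover have "times_module R (set fs) (quot_module R I) \<subseteq> carrier (quot_module R I)"
      proof -
        interpret M: module R "quot_module R I"
          using module_quot_module[OF R.is_cring I.is_ideal] .
        show ?thesis unfolding times_module_def
          using M.carrier_is_submodule M.smult_closed reg by (intro Inter_lower) blast
      qed
      ultimately show False using reg by blast
    qed
    show "set fs \<subseteq> carrier (poly_ring V)" using reg by (simp add: R_def)
    show "(\<Sum>es\<in>exps n (length fs). Poly_Mapping.single 0 (c es) * list_monom fs es) \<in> J 0"
      using assms(3) J(2)[of 0] by blast
  qed fact
qed

text \<open>The \<open>(n + 1) ^ r\<close> products are independent modulo \<open>I\<close> and have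
  representatives in the span of at most \<open>K * (n + 1) ^ d\<close> standard monomials; a large
  \<open>n\<close> forces \<open>r \<le> d\<close>.\<close>

lemma length_regular_sequence_le:
  fixes I :: "('v, 'k::field) mpoly set"
  assumes V: "finite V" and I: "ideal I (poly_ring V)"
    and d: "\<And>t. Poly_Mapping.keys t \<subseteq> V \<Longrightarrow> (monomial t :: ('v, 'k) mpoly) \<notin> I \<Longrightarrow> card (Poly_Mapping.keys t) \<le> d"
    and reg: "regular_sequence (poly_ring V) (quot_module (poly_ring V) I) fs"
  shows "length fs \<le> d"
proof -
  let ?r = "length fs"
  have fs: "set fs \<subseteq> carrier (poly_ring V)"
    using reg by (simp add: regular_sequence_def)
  obtain D0 where D0: "exps_le f (D0 f)" for f :: "('v, 'k) mpoly"
    using exps_le_ex by metis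
  define D where "D = (\<Sum>f\<in>set fs. D0 f)"
  have D: "exps_le f D" if "f \<in> set fs" for f
    using exps_le_mono[OF D0] member_le_sum[OF that, of D0] by (simp add: D_def)
  \<comment> \<open>Independent of \<open>n\<close>: it combines the number of supports with the
    estimate \<open>r * n * D + 1 \<le> (r * D + 1) * (n + 1)\<close>.\<close>
  define K where "K = 2 ^ card V * (?r * D + 1) ^ d"
  have bound: "(n + 1) ^ ?r \<le> K * (n + 1) ^ d" for n
  proof -
    let ?N = "?r * n * D"
    let ?T = "{t. Poly_Mapping.keys t \<subseteq> V \<and> card (Poly_Mapping.keys t) \<le> d \<and>
      (\<forall>x. Poly_Mapping.lookup t x \<le> ?N)}"
    let ?B = "monomial ` ?T :: ('v, 'k) mpoly set"
    have "\<forall>es\<in>exps n ?r. \<exists>w. w \<in> mpoly.span ?B \<and> list_monom fs es - w \<in> I"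
    proof
      fix es assume es: "es \<in> exps n ?r"
      have carr: "list_monom fs es \<in> carrier (poly_ring V)"
        by (rule carrier_list_monom[OF fs])
      obtain w where w: "w \<in> mpoly.span (monomial ` {t \<in> Poly_Mapping.keys (list_monom fs es). monomial t \<notin> I})"
        "list_monom fs es - w \<in> I"
        by (rule mod_ideal_standard_monomials[OF I carr])
      have "exps_le (list_monom fs es) ?N"
        using D es by (rule exps_le_list_monom)
      hence "{t \<in> Poly_Mapping.keys (list_monom fs es). monomial t \<notin> I} \<subseteq> ?T"
        using carr d unfolding carrier_poly_ring indets_def exps_le_def by blast
      hence "w \<in> mpoly.span ?B"
        using w(1) mpoly.span_mono[OF image_mono] by blast
      thus "\<exists>w. w \<in> mpoly.span ?B \<and> list_monom fs es - w \<in> I"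
        using w(2) by blast
    qed
    from bchoice[OF this] obtain w where
      ex: "\<forall>es\<in>exps n ?r. w es \<in> mpoly.span ?B \<and> list_monom fs es - w es \<in> I" ..
    have w: "w es \<in> mpoly.span ?B" "list_monom fs es - w es \<in> I" if "es \<in> exps n ?r" for es
      by (rule conjunct1[OF bspec[OF ex that]], rule conjunct2[OF bspec[OF ex that]])
    have "card (exps n ?r) \<le> card ?B"
    proof (rule mpoly_card_le_of_independent[OF finite_exps _ w(1)])
      show "finite ?B" using card_bounded_support_exponents(1)[OF V] by blast
      fix c es
      assume zero: "(\<Sum>es\<in>exps n ?r. Poly_Mapping.single 0 (c es) * w es) = 0" and es: "es \<in> exps n ?r"
      \<comment> \<open>Replacing each \<open>w es\<close> by the product it represents changes the
        sum by an element of \<open>I\<close>, so a relation among the representatives is a relation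
        modulo \<open>I\<close> among the products.\<close>
      have "(\<Sum>es\<in>exps n ?r. Poly_Mapping.single 0 (c es) * list_monom fs es)
          = (\<Sum>es\<in>exps n ?r. Poly_Mapping.single 0 (c es) * list_monom fs es)
            - (\<Sum>es\<in>exps n ?r. Poly_Mapping.single 0 (c es) * w es)"
        unfolding zero by simp
      also have "\<dots> = (\<Sum>es\<in>exps n ?r. Poly_Mapping.single 0 (c es) * (list_monom fs es - w es))"
        by (simp only: sum_subtractf right_diff_distrib)
      also have "\<dots> \<in> I"
        using w(2) by (intro poly_ideal_sum[OF I] poly_ideal_mult[OF I] carrier_poly_ring_single) auto
      finally show "c es = 0"
        by (rule regular_sequence_independent[OF I reg _ es])
    qed
    also have "card ?B \<le> card ?T"
      using card_bounded_support_exponents(1)[OF V] by (rule card_image_le)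
    also have "\<dots> \<le> 2 ^ card V * (?N + 1) ^ d"
      by (rule card_bounded_support_exponents(2)[OF V])
    also have "\<dots> \<le> 2 ^ card V * ((?r * D + 1) * (n + 1)) ^ d"
      by (intro mult_left_mono power_mono) (simp_all add: algebra_simps)
    also have "\<dots> = K * (n + 1) ^ d"
      by (simp only: K_def power_mult_distrib mult.assoc)
    finally show ?thesis
      by (simp only: card_exps)
  qed
  show ?thesis
  proof (rule ccontr)
    assume "\<not> ?r \<le> d"
    \<comment> \<open>The choice \<open>n = K\<close> in \<open>bound\<close> suffices:
      \<open>K * (K + 1) ^ d\<close> is less than \<open>(K + 1) ^ Suc d\<close>.\<close>
    hence "(K + 1) ^ Suc d \<le> (K + 1) ^ ?r" by (intro power_increasing) auto
    also have "\<dots> \<le> K * (K + 1) ^ d" by (rule bound)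
    finally show False by simp
  qed
qed

section \<open>The irrelevant ideal and the general depth bound\<close>

lemma ideal_irrelevant: "ideal (Idl\<^bsub>poly_ring V\<^esub> (indet ` V)) (poly_ring V :: ('v, 'k::field) mpoly ring)"
  by (intro ring.genideal_ideal cring.axioms(1)[OF cring_poly_ring])
    (auto simp: indet_def monomial_def intro!: carrier_poly_ring_single)

text \<open>Polynomials with zero constant term form an ideal that contains the indeterminates but
  not \<open>1\<close>.\<close>

lemma one_notin_irrelevant:
  "(1 :: ('v, 'k::field) mpoly) \<notin> Idl\<^bsub>poly_ring V\<^esub> (indet ` V)"
proof -
  let ?A = "{p \<in> carrier (poly_ring V). Poly_Mapping.lookup p 0 = (0::'k)}"
  interpret R: cring "poly_ring V :: ('v, 'k) mpoly ring" by (rule cring_poly_ring)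
  have mult: "p * q \<in> ?A" if pq: "p \<in> carrier (poly_ring V)" "q \<in> ?A" for p q :: "('v, 'k) mpoly"
  proof -
    have "0 \<notin> Poly_Mapping.keys (p * q)"
    proof
      assume "0 \<in> Poly_Mapping.keys (p * q)"
      then obtain a b where ab: "0 = a + b" "b \<in> Poly_Mapping.keys q"
        using keys_mult[of p q] by blast
      \<comment> \<open>Exponents are natural numbers, so a sum vanishes only if both summands
        do.\<close>
      have "b = 0"
      proof (rule poly_mapping_eqI)
        fix x
        have "Poly_Mapping.lookup a x + Poly_Mapping.lookup b x = 0"
          using ab(1) by (metis lookup_add lookup_zero)
        thus "Poly_Mapping.lookup b x = Poly_Mapping.lookup 0 x" by simp
      qed
      thus False using ab(2) pq(2) by (simp add: in_keys_iff)
    qed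
    thus ?thesis using pq by (simp add: in_keys_iff carrier_poly_ring_mult)
  qed
  have "ideal ?A (poly_ring V)"
  proof (rule idealI)
    show "subgroup ?A (add_monoid (poly_ring V))"
    proof (rule group.subgroupI[OF R.a_group])
      show "?A \<noteq> {}" using carrier_poly_ring_0_1(1) by fastforce
      show "inv\<^bsub>add_monoid (poly_ring V)\<^esub> p \<in> ?A" if "p \<in> ?A" for p
      proof -
        have "p \<oplus>\<^bsub>poly_ring V\<^esub> (\<ominus>\<^bsub>poly_ring V\<^esub> p) = \<zero>\<^bsub>poly_ring V\<^esub>"
          using that by (intro R.r_neg) simp
        hence "p + (\<ominus>\<^bsub>poly_ring V\<^esub> p) = 0" by simp
        hence "\<ominus>\<^bsub>poly_ring V\<^esub> p = - p" by (rule minus_unique[symmetric])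
        moreover have "\<ominus>\<^bsub>poly_ring V\<^esub> p \<in> carrier (poly_ring V)"
          using that by (intro R.a_inv_closed) simp
        ultimately show ?thesis using that by (simp add: a_inv_def)
      qed
    qed (auto simp: lookup_add intro: carrier_poly_ring_add)
    show "x \<otimes>\<^bsub>poly_ring V\<^esub> a \<in> ?A" "a \<otimes>\<^bsub>poly_ring V\<^esub> x \<in> ?A"
      if "a \<in> ?A" "x \<in> carrier (poly_ring V)" for a x
      using mult[OF that(2,1)] by (simp_all add: mult.commute)
  qed (rule R.ring_axioms)
  moreover have "indet ` V \<subseteq> ?A"
  proof
    fix p :: "('v, 'k) mpoly" assume "p \<in> indet ` V"
    then obtain x where x: "x \<in> V" "p = indet x" by blast
    have "Poly_Mapping.single x (1::nat) \<noteq> 0" by (metis lookup_single_eq lookup_zero zero_neq_one)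
    thus "p \<in> ?A"
      using x by (auto simp: indet_def monomial_def lookup_single when_def intro: carrier_poly_ring_single)
  qed
  ultimately have "Idl\<^bsub>poly_ring V\<^esub> (indet ` V) \<subseteq> ?A" by (rule R.genideal_minimal)
  moreover have "(1 :: ('v, 'k) mpoly) \<notin> ?A" by simp
  ultimately show ?thesis by blast
qed

text \<open>Containment in the irrelevant ideal makes \<open>grade\<close> a supremum of lengths,
  each at most \<open>d\<close>. For a proper square-free monomial ideal the least such
  \<open>d\<close> is the dimension of the quotient.\<close>

theorem depth_quot_le:
  fixes I :: "('v, 'k::field) mpoly set"
  assumes V: "finite V" and I: "ideal I (poly_ring V)" and "I \<subseteq> Idl\<^bsub>poly_ring V\<^esub> (indet ` V)"
    and d: "\<And>t. Poly_Mapping.keys t \<subseteq> V \<Longrightarrow> (monomial t :: ('v, 'k) mpoly) \<notin> I \<Longrightarrow> card (Poly_Mapping.keys t) \<le> d"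
  shows "depth V (quot_module (poly_ring V) I) \<le> enat d"
proof -
  have "times_module (poly_ring V) (Idl\<^bsub>poly_ring V\<^esub> (indet ` V)) (quot_module (poly_ring V) I)
      \<noteq> carrier (quot_module (poly_ring V) I)"
    by (rule cring.times_module_quot_proper[OF cring_poly_ring I ideal_irrelevant assms(3)])
      (simp add: one_notin_irrelevant)
  thus ?thesis
    unfolding depth_def grade_def
    using length_regular_sequence_le[OF V I d] by (auto intro!: SUP_least)
qed

section \<open>The whiskered cycle\<close>

lemma verts_whiskered_cycle: "verts (whiskered_cycle m) = Vx ` {1..m} \<union> Vy ` {1..m}"
  by (simp add: whiskered_cycle_def)

lemma finite_verts_whiskered_cycle: "finite (verts (whiskered_cycle m))"
  by (simp add: verts_whiskered_cycle)

text \<open>A matching \<open>M\<close> covers \<open>2 * card M\<close> of the \<open>2 * m\<close>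
  vertices, and the \<open>m\<close> whiskers attain the bound.\<close>

lemma matching_number_whiskered_cycle:
  assumes m: "m \<ge> 3"
  shows "matching_number (whiskered_cycle m) = m"
proof -
  let ?G = "whiskered_cycle m"
  let ?W = "(\<lambda>i. {Vx i, Vy i}) ` {1..m}"
  have G: "finite (verts ?G)" "\<And>e. e \<in> edges ?G \<Longrightarrow> e \<subseteq> verts ?G" "\<And>e. e \<in> edges ?G \<Longrightarrow> card e = 2"
    using finite_simple_graph_whiskered_cycle[OF m] by (auto simp: finite_simple_graph_def)
  have card_verts: "card (verts ?G) = 2 * m"
    unfolding verts_whiskered_cycle
    by (subst card_Un_disjoint) (auto simp: card_image inj_on_def)
  have le: "card M \<le> m" if "is_matching ?G M" for M
  proof -
    have M: "M \<subseteq> edges ?G" "disjoint M" using that by (auto simp: is_matching_def)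
    have "card (\<Union> M) = (\<Sum>e\<in>M. card e)"
    proof (rule card_Union_disjoint)
      show "pairwise disjnt M" using M(2) by (auto simp: disjoint_def pairwise_def disjnt_def)
      show "finite e" if "e \<in> M" for e
        using M(1) that by (intro finite_subset[OF G(2) G(1)]) blast
    qed
    also have "\<dots> = (\<Sum>e\<in>M. 2)" using M(1) G(3) by (intro sum.cong) auto
    also have "\<dots> = 2 * card M" by simp
    finally have "2 * card M = card (\<Union> M)" by simp
    also have "\<dots> \<le> card (verts ?G)" using M G by (intro card_mono) auto
    finally show ?thesis using card_verts by simp
  qed
  have "is_matching ?G ?W"
    by (auto simp: is_matching_def whiskered_cycle_def disjoint_def)
  moreover have "card ?W = m"
    by (subst card_image) (auto simp: inj_on_def doubleton_eq_iff)
  ultimately have "m \<in> card ` {M. is_matching ?G M}" by force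
  moreover have "card ` {M. is_matching ?G M} \<subseteq> {..m}" using le by auto
  ultimately show ?thesis
    unfolding matching_number_def by (intro Max_eqI) (auto dest: finite_subset)
qed

section \<open>Powers of the edge ideal and their square-free parts\<close>

lemma ideals_set_sel:
  "one (ideals_set R) = carrier R" "monoid.mult (ideals_set R) = ideal_prod R"
  by (simp_all add: ideals_set_def)

lemma (in cring) ideal_power_ideal:
  assumes "ideal J R"
  shows "ideal (J [^]\<^bsub>ideals_set R\<^esub> (n::nat)) R"
  using assms by (induction n) (simp_all add: ideals_set_sel oneideal ideal_prod_is_ideal)

text \<open>A product of ideals lies in its last factor. The zeroth power is the whole ring, whence
  \<open>n \<ge> 1\<close>.\<close>

lemma (in cring) ideal_power_subset:
  assumes "ideal J R" "n \<ge> 1"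
  shows "J [^]\<^bsub>ideals_set R\<^esub> (n::nat) \<subseteq> J"
  using assms(2) ideal_prod_inter[OF ideal_power_ideal[OF assms(1)] assms(1)]
  by (cases n) (auto simp: ideals_set_sel)

text \<open>The exponent vector of the generator attached to the matching formed by the whiskers
  with index in \<open>A\<close>.\<close>

definition whisker_exp :: "nat set \<Rightarrow> wvertex \<Rightarrow>\<^sub>0 nat" where
  "whisker_exp A = (\<Sum>i\<in>A. Poly_Mapping.single (Vx i) 1 + Poly_Mapping.single (Vy i) 1)"

lemma lookup_whisker_exp:
  assumes "finite A"
  shows "Poly_Mapping.lookup (whisker_exp A) (Vx i) = (if i \<in> A then 1 else 0)"
    and "Poly_Mapping.lookup (whisker_exp A) (Vy i) = (if i \<in> A then 1 else 0)"
  using assms by (simp_all add: whisker_exp_def lookup_sum lookup_add lookup_single when_def)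

lemma edge_ideal_gens:
  assumes "finite_simple_graph G"
  shows "{indet x * indet y | x y. {x, y} \<in> edges G} \<subseteq> carrier (poly_ring (verts G) :: ('v, 'k::field) mpoly ring)"
proof -
  have "{x, y} \<subseteq> verts G" if "{x, y} \<in> edges G" for x y
    using that assms unfolding finite_simple_graph_def by blast
  thus ?thesis
    by (auto simp: indet_def monomial_def intro!: carrier_poly_ring_mult carrier_poly_ring_single)
qed

lemma ideal_edge_ideal:
  assumes "finite_simple_graph G"
  shows "ideal (edge_ideal G) (poly_ring (verts G) :: ('v, 'k::field) mpoly ring)"
  unfolding edge_ideal_def
  by (intro ring.genideal_ideal cring.axioms(1)[OF cring_poly_ring] edge_ideal_gens assms)

lemma indet_mult_in_edge_ideal:
  assumes "finite_simple_graph G" "{x, y} \<in> edges G"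
  shows "indet x * indet y \<in> (edge_ideal G :: ('v, 'k::field) mpoly set)"
  using ring.genideal_self[OF cring.axioms(1)[OF cring_poly_ring] edge_ideal_gens[OF assms(1)]] assms(2)
  unfolding edge_ideal_def by blast

lemma
  assumes "finite_simple_graph G"
  shows ideal_squarefree_power:
      "ideal (squarefree_power G k) (poly_ring (verts G) :: ('v, 'k::field) mpoly ring)"
    and squarefree_power_gens:
      "{p \<in> edge_ideal G [^]\<^bsub>ideals_set (poly_ring (verts G))\<^esub> k. squarefree_monomial p}
        \<subseteq> (squarefree_power G k :: ('v, 'k::field) mpoly set)"
    and squarefree_power_subset_irrelevant:
      "k \<ge> 1 \<Longrightarrow> (squarefree_power G k :: ('v, 'k::field) mpoly set)
        \<subseteq> Idl\<^bsub>poly_ring (verts G)\<^esub> (indet ` verts G)"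
proof -
  let ?R = "poly_ring (verts G) :: ('v, 'k) mpoly ring"
  let ?E = "edge_ideal G :: ('v, 'k) mpoly set"
  let ?M = "Idl\<^bsub>?R\<^esub> (indet ` verts G)"
  interpret R: cring ?R by (rule cring_poly_ring)
  note E = ideal_edge_ideal[OF assms, where 'k = 'k]
  have carr: "{p \<in> ?E [^]\<^bsub>ideals_set ?R\<^esub> k. squarefree_monomial p} \<subseteq> carrier ?R"
    using ideal.Icarr[OF R.ideal_power_ideal[OF E]] by blast
  show "ideal (squarefree_power G k) ?R"
    unfolding squarefree_power_def Let_def by (rule R.genideal_ideal[OF carr])
  show "{p \<in> ?E [^]\<^bsub>ideals_set ?R\<^esub> k. squarefree_monomial p} \<subseteq> squarefree_power G k"
    unfolding squarefree_power_def Let_def by (rule R.genideal_self[OF carr])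
  show "squarefree_power G k \<subseteq> ?M" if "k \<ge> 1"
  proof -
    \<comment> \<open>Edge generators are multiples of indeterminates, so the edge ideal and all its
      positive powers lie in the irrelevant ideal.\<close>
    have "indet x * indet y \<in> ?M" if xy: "{x, y} \<in> edges G" for x y
    proof (rule poly_ideal_mult[OF ideal_irrelevant])
      have V: "x \<in> verts G" "y \<in> verts G" using xy assms by (auto simp: finite_simple_graph_def)
      show "indet x \<in> carrier ?R"
        using V by (simp add: indet_def monomial_def carrier_poly_ring_single)
      have "indet ` verts G \<subseteq> carrier ?R"
        by (auto simp: indet_def monomial_def intro!: carrier_poly_ring_single)
      thus "indet y \<in> ?M" using R.genideal_self V by blast
    qed
    hence "?E \<subseteq> ?M"
      unfolding edge_ideal_def by (intro R.genideal_minimal ideal_irrelevant) blast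
    hence "{p \<in> ?E [^]\<^bsub>ideals_set ?R\<^esub> k. squarefree_monomial p} \<subseteq> ?M"
      using R.ideal_power_subset[OF E that] by blast
    thus ?thesis
      unfolding squarefree_power_def Let_def by (intro R.genideal_minimal ideal_irrelevant)
  qed
qed

text \<open>By induction on \<open>A\<close>: each new whisker contributes one edge generator, hence
  one more factor of the ideal power.\<close>

lemma whisker_monomial_in_power:
  assumes m: "m \<ge> 3" and A: "A \<subseteq> {1..m}"
  shows "(monomial (whisker_exp A) :: (wvertex, 'k::field) mpoly)
    \<in> edge_ideal (whiskered_cycle m) [^]\<^bsub>ideals_set (poly_ring (verts (whiskered_cycle m)))\<^esub> card A"
proof -
  have "finite A" using A finite_subset by blast
  thus ?thesis using A
  proof (induction A)
    case empty
    have "(monomial 0 :: (wvertex, 'k) mpoly) = 1" by (simp add: monomial_def)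
    thus ?case by (simp add: ideals_set_sel whisker_exp_def carrier_poly_ring_0_1)
  next
    case (insert i A)
    let ?R = "poly_ring (verts (whiskered_cycle m)) :: (wvertex, 'k) mpoly ring"
    have "{Vx i, Vy i} \<in> edges (whiskered_cycle m)"
      using insert.prems by (auto simp: whiskered_cycle_def)
    hence "(indet (Vx i) * indet (Vy i) :: (wvertex, 'k) mpoly) \<in> edge_ideal (whiskered_cycle m)"
      by (rule indet_mult_in_edge_ideal[OF finite_simple_graph_whiskered_cycle[OF m]])
    hence "monomial (whisker_exp A) \<otimes>\<^bsub>?R\<^esub> (indet (Vx i) * indet (Vy i))
        \<in> edge_ideal (whiskered_cycle m) [^]\<^bsub>ideals_set ?R\<^esub> Suc (card A)"
      unfolding nat_pow_Suc ideals_set_sel using insert by (intro ideal_prod.prod) auto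
    moreover have "monomial (whisker_exp A) \<otimes>\<^bsub>?R\<^esub> (indet (Vx i) * indet (Vy i)) = monomial (whisker_exp (insert i A))"
      using insert.hyps
      by (simp add: monomial_def indet_def mult_single whisker_exp_def add.commute)
    ultimately show ?case using insert.hyps by simp
  qed
qed

text \<open>A monomial outside the \<open>k\<close>-th square-free power is divisible by both ends of fewer than
  \<open>k\<close> whiskers.\<close>

lemma card_keys_standard_monomial:
  assumes m: "m \<ge> 3" and k: "k \<ge> 1"
    and t: "Poly_Mapping.keys t \<subseteq> verts (whiskered_cycle m)"
    and notin: "(monomial t :: (wvertex, 'k::field) mpoly) \<notin> squarefree_power (whiskered_cycle m) k"
  shows "card (Poly_Mapping.keys t) \<le> m + k - 1"
proof -
  let ?G = "whiskered_cycle m"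
  note G = finite_simple_graph_whiskered_cycle[OF m]
  define P where "P = {i \<in> {1..m}. Vx i \<in> Poly_Mapping.keys t}"
  define Q where "Q = {i \<in> {1..m}. Vy i \<in> Poly_Mapping.keys t}"
  have few: "card (P \<inter> Q) < k"
  proof (rule ccontr)
    assume "\<not> card (P \<inter> Q) < k"
    \<comment> \<open>Exactly \<open>k\<close> common indices give a square-free monomial of the
      \<open>k\<close>-th power that divides \<open>monomial t\<close>.\<close>
    then obtain A where A: "A \<subseteq> P \<inter> Q" "card A = k" "finite A"
      using obtain_subset_with_card_n[of k "P \<inter> Q"] by auto
    define u where "u = whisker_exp A"
    have lookup_u: "Poly_Mapping.lookup u x \<le> 1" "Poly_Mapping.lookup u x \<le> Poly_Mapping.lookup t x" for x
      using A by (cases x; force simp: u_def lookup_whisker_exp P_def Q_def in_keys_iff)+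
    have "A \<subseteq> {1..m}" using A by (auto simp: P_def)
    hence "(monomial u :: (wvertex, 'k) mpoly) \<in> edge_ideal ?G [^]\<^bsub>ideals_set (poly_ring (verts ?G))\<^esub> k"
      using whisker_monomial_in_power[OF m] A(2) unfolding u_def by blast
    moreover have "squarefree_monomial (monomial u :: (wvertex, 'k) mpoly)"
      using lookup_u(1) unfolding squarefree_monomial_def by blast
    ultimately have "(monomial u :: (wvertex, 'k) mpoly) \<in> squarefree_power ?G k"
      using squarefree_power_gens[OF G] by blast
    moreover have "Poly_Mapping.keys (t - u) \<subseteq> verts ?G"
      using t by (auto simp: in_keys_iff lookup_minus)
    hence "(monomial (t - u) :: (wvertex, 'k) mpoly) \<in> carrier (poly_ring (verts ?G))"
      unfolding monomial_def by (rule carrier_poly_ring_single)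
    ultimately have "(monomial (t - u) * monomial u :: (wvertex, 'k) mpoly) \<in> squarefree_power ?G k"
      by (intro poly_ideal_mult[OF ideal_squarefree_power[OF G]])
    \<comment> \<open>Subtraction of exponents is truncated; \<open>u \<le> t\<close> pointwise
      makes it exact.\<close>
    moreover have "t - u + u = t"
      using lookup_u(2) by (intro poly_mapping_eqI) (simp add: lookup_add lookup_minus)
    ultimately show False using notin by (simp add: monomial_def mult_single)
  qed
  have "Poly_Mapping.keys t = Vx ` P \<union> Vy ` Q"
    using t by (auto simp: P_def Q_def verts_whiskered_cycle)
  hence "card (Poly_Mapping.keys t) \<le> card (Vx ` P) + card (Vy ` Q)"
    by (simp add: card_Un_le)
  \<comment> \<open>Inclusion-exclusion separates the at most \<open>m\<close> indices that occur
    from the at most \<open>k - 1\<close> that occur twice.\<close>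
  also have "\<dots> = card (P \<union> Q) + card (P \<inter> Q)"
    using card_Un_Int[of P Q] by (simp add: card_image inj_on_def P_def Q_def)
  also have "card (P \<union> Q) \<le> card {1..m}"
    by (intro card_mono) (auto simp: P_def Q_def)
  finally show ?thesis using few k by simp
qed

theorem proposition5p9:
  fixes m :: nat
    and R :: "(wvertex, 'k::field) mpoly ring"
  assumes "m \<ge> 3"
    and "R = poly_ring (verts (whiskered_cycle m))"
  shows "matching_number (whiskered_cycle m) = m \<and>
    (\<forall>k. 1 \<le> k \<and> k \<le> matching_number (whiskered_cycle m) \<longrightarrow>
       depth (verts (whiskered_cycle m))
         (quot_module R (squarefree_power (whiskered_cycle m) k)) \<le> enat (m + k - 1))"
proof (intro conjI allI impI)
  note G = finite_simple_graph_whiskered_cycle[OF assms(1)]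
  show "matching_number (whiskered_cycle m) = m"
    using assms(1) by (rule matching_number_whiskered_cycle)
  fix k assume "1 \<le> k \<and> k \<le> matching_number (whiskered_cycle m)"
  hence k: "k \<ge> 1" by simp
  \<comment> \<open>The general bound is applied with \<open>d = m + k - 1\<close>, its support
    condition being the count of variables in a monomial outside the ideal.\<close>
  show "depth (verts (whiskered_cycle m))
      (quot_module R (squarefree_power (whiskered_cycle m) k)) \<le> enat (m + k - 1)"
    unfolding assms(2)
    by (intro depth_quot_le finite_verts_whiskered_cycle ideal_squarefree_power[OF G]
        squarefree_power_subset_irrelevant[OF G k] card_keys_standard_monomial[OF assms(1) k])
qed

end
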